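(* There exists a Puiseux monoid $M$ such that $M$ is an LFFM but its power monoid $\mathcal{P}_{\mathrm{fin}}(M)$ is not an LFFM.
   Context: All monoids are commutative semigroups with identity, written additively with identity $0$. A Puiseux monoid is a submonoid of $(\mathbb{Q}_{\ge 0},+)$. For a monoid $M$, the (finitary) power monoid $\mathcal{P}_{\mathrm{fin}}(M)$ is the set of all nonempty finite subsets of $M$ with operation $S+T := \{s+t \mid s\in S,\ t\in T\}$; its identity is $\{0\}$. Both a Puiseux monoid and its power monoid are reduced, i.e., their only invertible element is the identity. For a reduced monoid $N$, an element $a\in N\setminus\{0\}$ is an atom if whenever $a=r+s$ with $r,s\in N$, either $r=0$ or $s=0$. The monoid $N$ is atomic if every nonzero element of $N$ is a finite sum of atoms. A factorization of $x\in N$ is a finite multiset of atoms of $N$ (equivalently, an element of the free commutative monoid on the set of atoms of $N$) whose sum in $N$ is $x$; its length is the number of atoms in it, counting repetitions. The monoid $N$ is a length-finite factorization monoid (LFFM) if $N$ is atomic and for every $x\in N$ and every $k\in\mathbb{N}=\{1,2,\dots\}$ the set of factorizations of $x$ of length $k$ is finite. *)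

theory Defs
  imports Complex_Main "HOL-Library.Multiset" "HOL-Library.Set_Algebras"
begin

text \<open>
  Monoids are given by carrier sets inside a type of class \<^class>\<open>comm_monoid_add\<close>, with the
  ambient addition and zero. The theory Set_Algebras makes \<^typ>\<open>rat set\<close> such a type,
  with elementwise addition and zero \<open>{0}\<close>, so power monoids fit the same pattern.
\<close>

definition is_submonoid :: "'a::comm_monoid_add set \<Rightarrow> bool" where
  "is_submonoid N \<longleftrightarrow> 0 \<in> N \<and> (\<forall>x\<in>N. \<forall>y\<in>N. x + y \<in> N)"

definition is_reduced :: "'a::comm_monoid_add set \<Rightarrow> bool" where
  "is_reduced N \<longleftrightarrow> (\<forall>x\<in>N. (\<exists>y\<in>N. x + y = 0) \<longrightarrow> x = 0)"

definition puiseux_monoid :: "rat set \<Rightarrow> bool" where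
  "puiseux_monoid M \<longleftrightarrow> is_submonoid M \<and> (\<forall>q\<in>M. 0 \<le> q)"

definition fin_power_monoid :: "'a::comm_monoid_add set \<Rightarrow> 'a set set" where
  "fin_power_monoid M = {S. S \<subseteq> M \<and> finite S \<and> S \<noteq> {}}"

text \<open>
  The notions below are the usual ones for carriers satisfying \<^const>\<open>is_submonoid\<close> and
  \<^const>\<open>is_reduced\<close>; the lemmas at the end show that Puiseux monoids and their power monoids
  do so.
\<close>

definition atoms :: "'a::comm_monoid_add set \<Rightarrow> 'a set" where
  "atoms N = {a \<in> N. a \<noteq> 0 \<and> (\<forall>r\<in>N. \<forall>s\<in>N. a = r + s \<longrightarrow> r = 0 \<or> s = 0)}"

definition factorizations :: "'a::comm_monoid_add set \<Rightarrow> 'a \<Rightarrow> 'a multiset set" where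
  "factorizations N x = {F. set_mset F \<subseteq> atoms N \<and> \<Sum>\<^sub># F = x}"

definition atomic :: "'a::comm_monoid_add set \<Rightarrow> bool" where
  "atomic N \<longleftrightarrow> (\<forall>x\<in>N. x \<noteq> 0 \<longrightarrow> factorizations N x \<noteq> {})"

definition LFFM :: "'a::comm_monoid_add set \<Rightarrow> bool" where
  "LFFM N \<longleftrightarrow>
     atomic N \<and> (\<forall>x\<in>N. \<forall>k::nat. k \<ge> 1 \<longrightarrow> finite {F \<in> factorizations N x. size F = k})"

lemma puiseux_monoid_reduced:
  assumes "puiseux_monoid M"
  shows "is_submonoid M" and "is_reduced M"
  using assms by (auto simp: puiseux_monoid_def is_reduced_def add_nonneg_eq_0_iff)

lemma fin_power_monoid_submonoid:
  assumes "is_submonoid M"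
  shows "is_submonoid (fin_power_monoid M)"
  using assms
  by (auto simp: is_submonoid_def fin_power_monoid_def finite_set_plus set_plus_def set_zero
      subset_eq)

lemma fin_power_monoid_reduced:
  assumes "puiseux_monoid M"
  shows "is_reduced (fin_power_monoid M)"
  unfolding is_reduced_def
proof (intro ballI impI)
  fix S assume S: "S \<in> fin_power_monoid M" and "\<exists>T\<in>fin_power_monoid M. S + T = 0"
  then obtain T where T: "T \<in> fin_power_monoid M" and ST: "S + T = {0}"
    by (auto simp: set_zero)
  from T obtain t where t: "t \<in> T" "t \<in> M"
    by (auto simp: fin_power_monoid_def)
  have "s = 0" if "s \<in> S" for s
  proof -
    have "s + t \<in> S + T" using that t by (intro set_plus_intro)
    then have "s + t = 0" using ST by simp
    moreover have "s \<in> M" using S that by (auto simp: fin_power_monoid_def)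
    ultimately show ?thesis
      using assms t by (auto simp: puiseux_monoid_def add_nonneg_eq_0_iff)
  qed
  then have "S = {0}" using S by (auto simp: fin_power_monoid_def)
  then show "S = 0" by (simp add: set_zero)
qed

end

theory Submission
  imports Defs "HOL-Computational_Algebra.Primes"
begin

text \<open>
  For each \<open>n\<close> take two primes \<open>p\<close>, \<open>q\<close>, all distinct, and three generators
  \<open>a = 4 / p\<close>, \<open>c = (2 - a) / p\<close> and \<open>d = (3 - a) / q\<close>.
  They are made so that \<open>2 = a + p c\<close> and \<open>3 = a + q d\<close>. In the power monoid this gives
  \<open>{2, 3} = {a} + {2 - a, 3 - a} = {a} + {p c, q d}\<close>,
  one factorization of length two for each \<open>n\<close>, once both summands are known to be atoms. In the
  monoid itself nothing comparable happens: to make an integer out of \<open>c\<close> costs \<open>p\<close> copies of it,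
  so the factorizations of 2 and 3 become longer and longer with \<open>n\<close>.

  Everything rests on divisibility. The generators of different indices have coprime denominators,
  so in a sum of generators that is an integer the contribution of each single index is
  an integer (\<open>part_integer\<close>). Modulo \<open>p\<close> and \<open>q\<close> this forces \<open>c\<close> to occur \<open>p b\<close> times, \<open>d\<close> to
  occur \<open>q e\<close> times and \<open>a\<close> to occur \<open>b + e + p t\<close> times, with contribution \<open>2 b + 3 e + 4 t\<close>
  (\<open>integer_part_counts\<close>). If the sum is at most 3, then \<open>t = 0\<close>: a positive \<open>t\<close> contributes
  at least 4, and a negative one needs \<open>b + e\<close> to be at least \<open>p\<close>. Hence the representations above are the only ones of 2 and 3
  (\<open>representation_of_2\<close>, \<open>representation_of_3\<close>). This uniqueness has two consequences. Each generator
  is an atom, since a decomposition of it could be substituted into the representation of 2 or 3 in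
  which it occurs. And \<open>2 - a\<close>, \<open>3 - a\<close> have no common divisor but 0, since the first is divisible
  by no generator but \<open>c\<close> and the second by none but \<open>d\<close>; hence the pair is an atom of the
  power monoid.

  For the monoid itself, fix \<open>z\<close> and a length \<open>k\<close>. At an index \<open>n > k\<close> whose primes do not
  occur in the denominator of \<open>z\<close> the contribution of a factorization of \<open>z\<close> is again an integer, but
  fewer than \<open>p\<close> and fewer than \<open>q\<close> generators are available, so by the same congruences
  none is used. Thus only finitely many generators can occur (\<open>idx_bounded\<close>).
\<close>

section \<open>Pairs of primes\<close>

text \<open>
  Consecutive terms grow by a factor of more than three, so that for the pair \<open>p\<close>, \<open>q\<close> of
  neighbouring terms \<open>q\<close> cannot divide \<open>3 p - 4\<close>, the numerator of \<open>3 - 4 / p\<close>. The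
  start value keeps \<open>4 / p\<close> below 1.
\<close>
fun prime_seq :: "nat \<Rightarrow> nat" where
  "prime_seq 0 = 5"
| "prime_seq (Suc n) = (SOME r. prime r \<and> r > 3 * prime_seq n)"

definition p :: "nat \<Rightarrow> nat" where "p n = prime_seq (2 * n)"
definition q :: "nat \<Rightarrow> nat" where "q n = prime_seq (2 * n + 1)"

lemma prime_seq_Suc: "prime (prime_seq (Suc n)) \<and> prime_seq (Suc n) > 3 * prime_seq n"
proof -
  have "\<exists>r. prime r \<and> r > 3 * prime_seq n" by (rule bigger_prime)
  from someI_ex[OF this] show ?thesis by simp
qed

lemma prime_prime_seq: "prime (prime_seq n)"
  using prime_seq_Suc by (cases n) auto

lemma strict_mono_prime_seq: "strict_mono prime_seq"
  using prime_seq_Suc by (intro strict_mono_Suc_iff[THEN iffD2] allI)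
    (metis add_lessD1 mult_2 mult_Suc numeral_3_eq_3 numeral_2_eq_2)

lemma prime_p: "prime (p n)" and prime_q: "prime (q n)"
  by (simp_all add: p_def q_def prime_prime_seq del: prime_seq.simps)

lemma p_ge_5: "p n \<ge> 5"
  using strict_mono_less_eq[OF strict_mono_prime_seq, of 0 "2 * n"] by (simp add: p_def)

lemma q_gt: "q n > 3 * p n"
  using prime_seq_Suc[of "2 * n"] by (simp add: p_def q_def)

lemma p_pos [simp]: "p n > 0" and q_pos [simp]: "q n > 0"
  using p_ge_5[of n] q_gt[of n] by simp_all

lemma p_nonzero [simp]: "p n \<noteq> 0" and q_nonzero [simp]: "q n \<noteq> 0"
  using p_pos[of n] q_pos[of n] by linarith+

lemma p_ge: "p n \<ge> n" and q_ge: "q n \<ge> n"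
  using strict_mono_imp_increasing[OF strict_mono_prime_seq, of "2 * n"]
    strict_mono_imp_increasing[OF strict_mono_prime_seq, of "2 * n + 1"]
  by (simp_all add: p_def q_def del: prime_seq.simps)

lemma p_eq_iff: "p m = p n \<longleftrightarrow> m = n" and q_eq_iff: "q m = q n \<longleftrightarrow> m = n" and p_neq_q: "p m \<noteq> q n"
proof -
  note eq = strict_mono_eq[OF strict_mono_prime_seq]
  show "p m = p n \<longleftrightarrow> m = n" "q m = q n \<longleftrightarrow> m = n"
    by (simp_all only: p_def q_def eq, auto)
  show "p m \<noteq> q n"
    by (simp only: p_def q_def eq) presburger
qed

section \<open>The generators\<close>

text \<open>
  Sums are indexed by multisets of labels rather than of rationals. A label determines its index and
  its kind, so no injectivity of the values is needed to count occurrences.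
\<close>
datatype generator = Lead nat | Low nat | High nat

fun idx :: "generator \<Rightarrow> nat" where
  "idx (Lead n) = n" | "idx (Low n) = n" | "idx (High n) = n"

fun val :: "generator \<Rightarrow> rat" where
  "val (Lead n) = 4 / of_nat (p n)"
| "val (Low n) = (2 - 4 / of_nat (p n)) / of_nat (p n)"
| "val (High n) = (3 - 4 / of_nat (p n)) / of_nat (q n)"

definition total :: "generator multiset \<Rightarrow> rat" where
  "total F = (\<Sum>x\<in>#F. val x)"

lemma total_simps [simp]:
  "total {#} = 0" "total (add_mset x F) = val x + total F" "total (F + G) = total F + total G"
  "total (replicate_mset k x) = of_nat k * val x"
  by (simp_all add: total_def)

lemma val_pos: "val x > 0"
proof -
  have lead: "0 < 4 / rat_of_nat (p n)" "4 / rat_of_nat (p n) < 1" for n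
  proof -
    have "4 < rat_of_nat (p n)" using p_ge_5[of n] by simp
    then show "0 < 4 / rat_of_nat (p n)" "4 / rat_of_nat (p n) < 1" by (simp_all add: divide_less_eq)
  qed
  have pos: "rat_of_nat (p n) > 0" "rat_of_nat (q n) > 0" for n
    using p_ge_5[of n] q_gt[of n] by auto
  show ?thesis
  proof (cases x)
    case (Lead n)
    then show ?thesis using lead by simp
  next
    case (Low n)
    show ?thesis unfolding Low val.simps
      using lead[of n] pos[of n] by (intro divide_pos_pos) linarith+
  next
    case (High n)
    show ?thesis unfolding High val.simps
      using lead[of n] pos[of n] by (intro divide_pos_pos) linarith+
  qed
qed

lemma total_nonneg: "total F \<ge> 0"
  by (induction F) (auto intro: add_nonneg_nonneg less_imp_le[OF val_pos])

lemma total_eq_0_iff [simp]: "total F = 0 \<longleftrightarrow> F = {#}"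
  using val_pos total_nonneg by (cases F) (auto simp: add_pos_nonneg order.strict_implies_not_eq[symmetric])

lemma total_Low: "val (Lead n) + of_nat (p n) * val (Low n) = 2"
  using p_ge_5[of n] by simp

lemma total_High: "val (Lead n) + of_nat (q n) * val (High n) = 3"
  using q_gt[of n] by simp

text \<open>
  The contribution of a single index to a sum of generators is the object to which the congruences
  apply; the remaining summands have denominators prime to those of that index.
\<close>
definition part :: "nat \<Rightarrow> generator multiset \<Rightarrow> generator multiset" where
  "part n F = {#x \<in># F. idx x = n#}"

definition rest :: "nat \<Rightarrow> generator multiset \<Rightarrow> generator multiset" where
  "rest n F = {#x \<in># F. idx x \<noteq> n#}"

lemma part_rest: "F = part n F + rest n F"
  unfolding part_def rest_def by (rule multiset_partition)

lemma part_eq: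
  "part n F = replicate_mset (count F (Lead n)) (Lead n)
     + replicate_mset (count F (Low n)) (Low n) + replicate_mset (count F (High n)) (High n)"
proof (rule multiset_eqI)
  fix x show "count (part n F) x = count (replicate_mset (count F (Lead n)) (Lead n)
     + replicate_mset (count F (Low n)) (Low n) + replicate_mset (count F (High n)) (High n)) x"
    by (cases x) (auto simp: part_def)
qed

section \<open>Integrality of the contribution of one index\<close>

definition den :: "nat \<Rightarrow> int" where "den n = int (p n) ^ 2 * int (q n)"

lemma coprime_den: "m \<noteq> n \<Longrightarrow> coprime (den m) (den n)"
  unfolding den_def
  by (auto simp: coprime_mult_left_iff coprime_mult_right_iff coprime_int_iff
      intro!: primes_coprime prime_p prime_q simp: p_eq_iff q_eq_iff p_neq_q p_neq_q[symmetric])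

lemma den_val: "of_int (den (idx x)) * val x \<in> \<int>"
proof -
  have nz: "rat_of_nat (p n) \<noteq> 0" "rat_of_nat (q n) \<noteq> 0" for n
    by simp_all
  show ?thesis
  proof (cases x)
    case (Lead n)
    have "of_int (den (idx x)) * val x = of_int (4 * int (p n) * int (q n))"
      using nz by (simp add: Lead den_def field_simps power2_eq_square)
    then show ?thesis by (metis Ints_of_int)
  next
    case (Low n)
    have "of_int (den (idx x)) * val x = of_int ((2 * int (p n) - 4) * int (q n))"
      using nz by (simp add: Low den_def field_simps power2_eq_square)
    then show ?thesis by (metis Ints_of_int)
  next
    case (High n)
    have "of_int (den (idx x)) * val x = of_int (int (p n) * (3 * int (p n) - 4))"
      using nz by (simp add: High den_def field_simps power2_eq_square)
    then show ?thesis by (metis Ints_of_int)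
  qed
qed

text \<open>
  For nonzero \<open>N\<close> these are the elements of the localization of the integers at the primes that
  divide \<open>N\<close>: the denominator of \<open>x\<close> is prime to \<open>N\<close>.
\<close>
definition integral_at :: "int \<Rightarrow> rat \<Rightarrow> bool" where
  "integral_at N x \<longleftrightarrow> (\<exists>E. coprime E N \<and> of_int E * x \<in> \<int>)"

lemma integral_at_Ints: "x \<in> \<int> \<Longrightarrow> integral_at N x"
  unfolding integral_at_def by (rule exI[of _ 1]) simp

lemma integral_at_add:
  assumes "integral_at N x" "integral_at N y"
  shows "integral_at N (x + y)"
proof -
  obtain E G where E: "coprime E N" "of_int E * x \<in> \<int>" and G: "coprime G N" "of_int G * y \<in> \<int>"
    using assms by (auto simp: integral_at_def)
  have "of_int (E * G) * (x + y) = of_int G * (of_int E * x) + of_int E * (of_int G * y)"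
    by (simp add: algebra_simps)
  also have "\<dots> \<in> \<int>"
    by (rule Ints_add[OF Ints_mult[OF Ints_of_int E(2)] Ints_mult[OF Ints_of_int G(2)]])
  finally show ?thesis using E G unfolding integral_at_def by (intro exI[of _ "E * G"]) simp
qed

lemma integral_at_minus: "integral_at N x \<Longrightarrow> integral_at N (- x)"
  unfolding integral_at_def by (metis Ints_minus mult_minus_right)

text \<open>
  A denominator that divides \<open>N\<close> and is prime to \<open>N\<close> is a unit; Bezout coefficients exhibit this.
\<close>
lemma integral_at_imp_Ints:
  assumes "integral_at N x" "of_int N * x \<in> \<int>"
  shows "x \<in> \<int>"
proof -
  obtain E where E: "coprime E N" "of_int E * x \<in> \<int>"
    using assms by (auto simp: integral_at_def)
  obtain u v where "u * E + v * N = 1"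
    using bezout_int[of E N] E by (auto simp: coprime_iff_gcd_eq_1)
  then have "x = of_int (u * E + v * N) * x" by simp
  also have "\<dots> = of_int u * (of_int E * x) + of_int v * (of_int N * x)"
    by (simp add: algebra_simps)
  also have "\<dots> \<in> \<int>"
    by (rule Ints_add[OF Ints_mult[OF Ints_of_int E(2)] Ints_mult[OF Ints_of_int assms(2)]])
  finally show ?thesis .
qed

lemma den_part: "of_int (den n) * total (part n F) \<in> \<int>"
  unfolding part_def
proof (induction F)
  case (add x F)
  then show ?case using den_val[of x] by (auto simp: distrib_left)
qed simp

lemma integral_at_rest: "integral_at (den n) (total (rest n F))"
  unfolding rest_def
proof (induction F)
  case (add x F)
  have "integral_at (den n) (val x)" if "idx x \<noteq> n"
    using coprime_den[OF that] den_val[of x] by (auto simp: integral_at_def)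
  with add show ?case by (auto intro: integral_at_add)
qed (simp add: integral_at_Ints)

text \<open>
  The contribution of index \<open>n\<close> is the total minus the contributions of the other indices, so it has a
  denominator prime to \<open>den n\<close>, while its own generators only allow denominators that divide
  \<open>den n\<close>.
\<close>
lemma part_integer:
  assumes "integral_at (den n) (total F)"
  shows "total (part n F) \<in> \<int>"
proof (rule integral_at_imp_Ints[OF _ den_part])
  have "total (part n F) = total F + - total (rest n F)"
    using arg_cong[OF part_rest[of F n], of total] by simp
  then show "integral_at (den n) (total (part n F))"
    using assms integral_at_rest integral_at_add integral_at_minus by metis
qed

text \<open>
  Clear denominators in the integer contribution. Modulo \<open>q\<close> only the \<open>High\<close> term survives and
  modulo \<open>p\<close> only the \<open>Low\<close> term, which gives the first two divisibilities. Since \<open>p\<close> copies of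
  \<open>Low n\<close> make \<open>2 - 4 / p\<close> and \<open>q\<close> copies of \<open>High n\<close> make \<open>3 - 4 / p\<close>, what is left is
  an integer plus \<open>4 / p\<close> times the excess of \<open>Lead\<close> over \<open>b + c\<close>; hence \<open>p\<close> divides this excess.
\<close>
lemma integer_part_counts:
  assumes "total (part n F) \<in> \<int>"
  obtains b c t where "count F (Low n) = p n * b" "count F (High n) = q n * c"
    "int (count F (Lead n)) = int b + int c + int (p n) * t"
    "total (part n F) = of_int (2 * int b + 3 * int c + 4 * t)"
proof -
  \<comment> \<open>\<open>?b\<close> and \<open>?c\<close> are the numbers of occurrences, \<open>b\<close> and \<open>c\<close> their quotients by \<open>p n\<close> and \<open>q n\<close>\<close>
  let ?P = "int (p n)" and ?Q = "int (q n)"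
  let ?a = "count F (Lead n)" and ?b = "count F (Low n)" and ?c = "count F (High n)"
  have nz: "rat_of_nat (p n) \<noteq> 0" "rat_of_nat (q n) \<noteq> 0"
    using p_ge_5[of n] q_gt[of n] by auto
  have P: "prime ?P" "?P \<ge> 5" and Q: "prime ?Q" "?Q > 3 * ?P"
    using prime_p prime_q p_ge_5[of n] q_gt[of n] by auto
  obtain w where w: "total (part n F) = of_int w" using assms by (auto elim: Ints_cases)
  have tot: "total (part n F) = of_nat ?a * val (Lead n) + of_nat ?b * val (Low n) + of_nat ?c * val (High n)"
    by (subst part_eq) simp
  have "rat_of_int (?P\<^sup>2 * ?Q * w)
      = of_int (int ?a * 4 * ?P * ?Q + int ?b * (2 * ?P - 4) * ?Q + int ?c * ?P * (3 * ?P - 4))"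
    using nz unfolding of_int_mult[of _ w] w[symmetric] tot
    by (simp add: field_simps power2_eq_square)
  then have eq: "?P\<^sup>2 * ?Q * w = int ?a * 4 * ?P * ?Q + int ?b * (2 * ?P - 4) * ?Q + int ?c * ?P * (3 * ?P - 4)"
    by (simp only: of_int_eq_iff)
  have Qn: "\<not> ?Q dvd ?P" "\<not> ?Q dvd 3 * ?P - 4" and Pn: "\<not> ?P dvd ?Q" "\<not> ?P dvd 4"
    using P Q zdvd_imp_le[of ?Q ?P] zdvd_imp_le[of ?Q "3 * ?P - 4"] zdvd_imp_le[of ?P 4]
      primes_dvd_imp_eq[of "p n" "q n"] prime_p prime_q p_neq_q[of n n] by auto
  have "int ?c * ?P * (3 * ?P - 4) = ?Q * (?P\<^sup>2 * w - int ?a * 4 * ?P - int ?b * (2 * ?P - 4))"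
    using eq by (simp add: algebra_simps)
  then have "?Q dvd int ?c * ?P * (3 * ?P - 4)" by simp
  then have "?Q dvd int ?c" using Qn Q prime_dvd_mult_iff by blast
  then obtain c where c: "?c = q n * c" by (auto simp: int_dvd_int_iff)
  have "int ?b * 4 * ?Q = ?P * (int ?a * 4 * ?Q + int ?b * 2 * ?Q + int ?c * (3 * ?P - 4) - ?P * ?Q * w)"
    using eq by (simp add: algebra_simps power2_eq_square)
  then have "?P dvd int ?b * 4 * ?Q" by simp
  then have "?P dvd int ?b" using Pn P prime_dvd_mult_iff by blast
  then obtain b where b: "?b = p n * b" by (auto simp: int_dvd_int_iff)
  have "(?P * ?Q) * (?P * w) = (?P * ?Q) * (4 * (int ?a - int b - int c) + ?P * (2 * int b + 3 * int c))"
    using eq unfolding b c by (simp add: algebra_simps power2_eq_square)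
  then have eq2: "?P * w = 4 * (int ?a - int b - int c) + ?P * (2 * int b + 3 * int c)"
    using P Q by (simp only: mult_cancel_left) auto
  then have "4 * (int ?a - int b - int c) = ?P * (w - (2 * int b + 3 * int c))"
    by (simp add: algebra_simps)
  then have "?P dvd 4 * (int ?a - int b - int c)" by simp
  then have "?P dvd int ?a - int b - int c" using Pn P prime_dvd_mult_iff by blast
  then obtain t where t: "int ?a - int b - int c = ?P * t" by auto
  have "?P * w = ?P * (2 * int b + 3 * int c + 4 * t)"
    using eq2 unfolding t by (simp add: algebra_simps)
  then have "w = 2 * int b + 3 * int c + 4 * t" using P by simp
  moreover have "int ?a = int b + int c + ?P * t" using t by simp
  ultimately show thesis using that[OF b c] w by simp
qed

section \<open>Representations of 2 and 3\<close>

lemma part_le: "total (part n F) \<le> total F"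
  using arg_cong[OF part_rest[of F n], of total] total_nonneg[of "rest n F"] by simp

text \<open>
  In the notation of \<open>integer_part_counts\<close>, \<open>t > 0\<close> would contribute at least 4. A negative \<open>t\<close>
  would force \<open>b + c \<ge> - t p\<close>, because the number of \<open>Lead\<close> generators is not negative, and then
  \<open>2 b + 3 c\<close> outweighs \<open>4 t\<close> by far. So \<open>t = 0\<close>, and \<open>2 b + 3 c \<le> 3\<close> leaves
  the two cases.
\<close>
lemma small_integer_part:
  assumes "total F \<in> \<int>" "total F \<le> 3" "x \<in># F"
  shows "part (idx x) F = add_mset (Lead (idx x)) (replicate_mset (p (idx x)) (Low (idx x)))
       \<or> part (idx x) F = add_mset (Lead (idx x)) (replicate_mset (q (idx x)) (High (idx x)))"
proof -
  define n where "n = idx x"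
  have "total (part n F) \<in> \<int>" by (intro part_integer integral_at_Ints assms)
  then obtain b c t where b: "count F (Low n) = p n * b" and c: "count F (High n) = q n * c"
    and a: "int (count F (Lead n)) = int b + int c + int (p n) * t"
    and w: "total (part n F) = of_int (2 * int b + 3 * int c + 4 * t)"
    by (rule integer_part_counts)
  have "rat_of_int (2 * int b + 3 * int c + 4 * t) \<le> of_int 3"
    using w part_le[of n F] assms by simp
  then have le: "2 * int b + 3 * int c + 4 * t \<le> 3" by (simp only: of_int_le_iff)
  then have "t \<le> 0" by linarith
  moreover have "\<not> t < 0"
  proof
    assume "t < 0"
    have "5 * - t \<le> int (p n) * - t"
      using p_ge_5[of n] \<open>t < 0\<close> by (intro mult_right_mono) auto
    then show False using a le \<open>t < 0\<close> by linarith
  qed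
  ultimately have t: "t = 0" by simp
  have "part n F \<noteq> {#}" using assms(3) by (auto simp: part_def n_def filter_mset_eq_mempty_iff)
  then have "b \<noteq> 0 \<or> c \<noteq> 0"
    using a b c t by (auto simp: part_eq[of n F])
  with le t consider "b = 1" "c = 0" | "b = 0" "c = 1" by force
  then show ?thesis
    unfolding n_def[symmetric] using a b c t by cases (simp_all add: part_eq[of n F])
qed

lemma total_part_2_or_3:
  assumes "total F \<in> \<int>" "total F \<le> 3" "x \<in># F"
  shows "total (part (idx x) F) = 2 \<or> total (part (idx x) F) = 3"
  using small_integer_part[OF assms] total_Low[of "idx x"] total_High[of "idx x"]
  by (elim disjE) (simp_all del: val.simps)

text \<open>
  Each index that occurs contributes at least 2, so a total of at most 3 has room for only one.
\<close>
lemma small_integer_representation: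
  assumes "total F \<in> \<int>" "total F \<le> 3" "x \<in># F"
  shows "F = add_mset (Lead (idx x)) (replicate_mset (p (idx x)) (Low (idx x)))
       \<or> F = add_mset (Lead (idx x)) (replicate_mset (q (idx x)) (High (idx x)))"
proof -
  let ?R = "rest (idx x) F"
  have split: "total F = total (part (idx x) F) + total ?R"
    using arg_cong[OF part_rest[of F "idx x"], of total] by simp
  note w = total_part_2_or_3[OF assms]
  have "?R = {#}"
  proof (rule ccontr)
    assume "?R \<noteq> {#}"
    then obtain y where y: "y \<in># ?R" by blast
    have le: "total ?R \<le> 1" using w split assms(2) by auto
    have "total ?R = total F - total (part (idx x) F)" using split by simp
    also have "\<dots> \<in> \<int>" using w assms(1) by auto
    finally have "total (part (idx y) ?R) \<ge> 2"
      using total_part_2_or_3[of ?R y] le y by force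
    then show False using part_le[of "idx y" ?R] le by linarith
  qed
  then show ?thesis
    using small_integer_part[OF assms] part_rest[of F "idx x"] by simp
qed

lemma representation_of_2:
  assumes "total F = 2" "x \<in># F"
  shows "F = add_mset (Lead (idx x)) (replicate_mset (p (idx x)) (Low (idx x)))"
  using small_integer_representation[of F x] assms total_High[of "idx x"] by auto

lemma representation_of_3:
  assumes "total F = 3" "x \<in># F"
  shows "F = add_mset (Lead (idx x)) (replicate_mset (q (idx x)) (High (idx x)))"
  using small_integer_representation[of F x] assms total_Low[of "idx x"] by auto

section \<open>A Puiseux monoid with finitely many factorizations of each length\<close>

definition prime_pair_monoid :: "rat set" where "prime_pair_monoid = range total"

lemma puiseux_prime_pair_monoid: "puiseux_monoid prime_pair_monoid"
proof -
  have "0 \<in> prime_pair_monoid"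
    unfolding prime_pair_monoid_def by (rule range_eqI[of _ _ "{#}"]) simp
  moreover have "total F + total G \<in> prime_pair_monoid" for F G
    unfolding prime_pair_monoid_def by (rule range_eqI[of _ _ "F + G"]) simp
  ultimately show ?thesis
    unfolding puiseux_monoid_def is_submonoid_def using total_nonneg
    by (auto simp: prime_pair_monoid_def)
qed

text \<open>
  A sum equal to a generator may replace one copy of this generator in the representation of 2 or 3
  that contains it. The result must be the same representation, and the other summands cancel.
\<close>
lemma val_representation:
  assumes "total F = val x"
  shows "F = {#x#}"
proof (cases x)
  case (Lead n)
  have "total (F + replicate_mset (p n) (Low n)) = 2"
    using assms total_Low[of n] by (simp add: Lead del: val.simps)
  from representation_of_2[OF this, of "Low n"]
  have "F + replicate_mset (p n) (Low n) = {#x#} + replicate_mset (p n) (Low n)"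
    by (simp add: Lead)
  then show ?thesis by (simp only: add_right_cancel)
next
  case (Low n)
  obtain k where k: "p n = Suc k" using p_ge_5[of n] by (cases "p n") auto
  have "total (add_mset (Lead n) (F + replicate_mset k (Low n))) = 2"
    using assms total_Low[of n] unfolding k by (simp add: Low algebra_simps del: val.simps)
  from representation_of_2[OF this, of "Lead n"]
  have "F + replicate_mset k (Low n) = {#x#} + replicate_mset k (Low n)"
    by (simp add: Low k)
  then show ?thesis by (simp only: add_right_cancel)
next
  case (High n)
  obtain k where k: "q n = Suc k" using q_gt[of n] by (cases "q n") auto
  have "total (add_mset (Lead n) (F + replicate_mset k (High n))) = 3"
    using assms total_High[of n] unfolding k by (simp add: High algebra_simps del: val.simps)
  from representation_of_3[OF this, of "Lead n"]
  have "F + replicate_mset k (High n) = {#x#} + replicate_mset k (High n)"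
    by (simp add: High k)
  then show ?thesis by (simp only: add_right_cancel)
qed

lemma atoms_prime_pair_monoid: "atoms prime_pair_monoid = range val"
proof (intro equalityI subsetI)
  fix a assume a: "a \<in> atoms prime_pair_monoid"
  then obtain F where F: "a = total F" "a \<noteq> 0" by (auto simp: atoms_def prime_pair_monoid_def)
  then obtain x G where G: "F = add_mset x G" by (cases F) auto
  have "val x \<in> prime_pair_monoid"
    unfolding prime_pair_monoid_def by (rule range_eqI[of _ _ "{#x#}"]) simp
  moreover have "total G \<in> prime_pair_monoid" unfolding prime_pair_monoid_def by (rule rangeI)
  moreover have "a = val x + total G" by (simp only: F(1) G total_simps)
  ultimately have "val x = 0 \<or> total G = 0" using a unfolding atoms_def by blast
  then have "total G = 0" using less_imp_neq[OF val_pos[of x], symmetric] by blast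
  then have "a = val x" by (simp only: F(1) G total_simps add_0_right)
  then show "a \<in> range val" by (rule range_eqI)
next
  fix a assume "a \<in> range val"
  then obtain x where x: "a = val x" by auto
  have "val x \<in> prime_pair_monoid"
    unfolding prime_pair_monoid_def by (rule range_eqI[of _ _ "{#x#}"]) simp
  moreover have "r = 0 \<or> s = 0" if rs: "r \<in> prime_pair_monoid" "s \<in> prime_pair_monoid" "val x = r + s" for r s
  proof -
    obtain F G where FG: "r = total F" "s = total G" using rs by (auto simp: prime_pair_monoid_def)
    have "F + G = {#x#}"
      by (rule val_representation) (simp only: total_simps FG rs(3))
    then have "F = {#} \<or> G = {#}" by (auto simp: union_is_single)
    then show ?thesis unfolding FG by (elim disjE) simp_all
  qed
  ultimately show "a \<in> atoms prime_pair_monoid"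
    unfolding atoms_def x mem_Collect_eq using val_pos[of x] by (metis order_less_irrefl)
qed

text \<open>
  The fixed representation \<open>F0\<close> of the element controls its denominator: an index that does not
  occur in \<open>F0\<close> is an index at which the element is integral. There, if any generator occurs, some
  generator occurs a positive multiple of \<open>p\<close> or \<open>q\<close> times; both primes are at least the index, so
  an index beyond \<open>k\<close> is impossible.
\<close>
lemma idx_bounded:
  assumes "total F = total F0" "size F = k" "x \<in># F"
  shows "idx x \<le> k \<or> idx x \<in> idx ` set_mset F0"
proof (rule ccontr)
  define n where "n = idx x"
  assume "\<not> ?thesis"
  then have k: "k < n" and "n \<notin> idx ` set_mset F0" by (auto simp: n_def)
  then have "rest n F0 = F0" unfolding rest_def by (auto simp: filter_mset_eq_conv)
  then have "total (part n F) \<in> \<int>"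
    using integral_at_rest[of n F0] assms(1) by (intro part_integer) simp
  then obtain b c t where b: "count F (Low n) = p n * b" and c: "count F (High n) = q n * c"
    and a: "int (count F (Lead n)) = int b + int c + int (p n) * t"
    by (rule integer_part_counts)
  have small: "count F y < p n" "count F y < q n" for y
    using count_le_size[of F y] k p_ge[of n] q_ge[of n] assms(2) by linarith+
  have "b = 0" using small(1)[of "Low n"] b by (cases b) auto
  moreover have "c = 0" using small(2)[of "High n"] c by (cases c) auto
  moreover from calculation have "int (p n) dvd int (count F (Lead n))" using a by simp
  then have "count F (Lead n) = 0" using small(1)[of "Lead n"] by (auto dest: dvd_imp_le)
  ultimately have "part n F = {#}" using b c by (simp add: part_eq)
  then show False using assms(3) by (auto simp: part_def n_def filter_mset_eq_mempty_iff)
qed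

lemma finite_idx: "finite I \<Longrightarrow> finite {x. idx x \<in> I}"
proof -
  assume I: "finite I"
  have "{x. idx x \<in> I} \<subseteq> Lead ` I \<union> Low ` I \<union> High ` I"
  proof
    fix x assume "x \<in> {x. idx x \<in> I}"
    then show "x \<in> Lead ` I \<union> Low ` I \<union> High ` I" by (cases x) auto
  qed
  then show ?thesis using I by (meson finite_UnI finite_imageI finite_subset)
qed

lemma LFFM_prime_pair_monoid: "LFFM prime_pair_monoid"
  unfolding LFFM_def
proof (intro conjI ballI allI impI)
  show "atomic prime_pair_monoid" unfolding atomic_def
  proof (intro ballI impI)
    fix z assume "z \<in> prime_pair_monoid"
    then obtain F where "z = total F" by (auto simp: prime_pair_monoid_def)
    then have "image_mset val F \<in> factorizations prime_pair_monoid z"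
      by (auto simp: factorizations_def atoms_prime_pair_monoid total_def)
    then show "factorizations prime_pair_monoid z \<noteq> {}" by blast
  qed
next
  fix z and k :: nat assume "z \<in> prime_pair_monoid"
  then obtain F0 where z: "z = total F0" by (auto simp: prime_pair_monoid_def)
  let ?I = "{..k} \<union> idx ` set_mset F0"
  let ?S = "{F. set_mset F \<subseteq> {x. idx x \<in> ?I} \<and> size F = k}"
  have "finite (multisets_of_size {x. idx x \<in> ?I} k)"
    by (intro finite_multisets_of_size finite_idx) auto
  then have "finite ?S" by (simp only: multisets_of_size_def)
  moreover have "{F \<in> factorizations prime_pair_monoid z. size F = k} \<subseteq> image_mset val ` ?S"
  proof
    fix H assume "H \<in> {F \<in> factorizations prime_pair_monoid z. size F = k}"
    then have H: "set_mset H \<subseteq> range val" "\<Sum>\<^sub># H = z" "size H = k"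
      by (auto simp: factorizations_def atoms_prime_pair_monoid)
    define F where "F = image_mset (inv val) H"
    have "image_mset val F = image_mset (\<lambda>a. val (inv val a)) H"
      by (simp add: F_def multiset.map_comp comp_def)
    also have "\<dots> = image_mset (\<lambda>a. a) H"
      using H(1) by (intro image_mset_cong f_inv_into_f) blast
    finally have HF: "H = image_mset val F" by simp
    have "total F = total F0" "size F = k"
      using H(2,3) z by (simp_all add: HF total_def)
    then have "set_mset F \<subseteq> {x. idx x \<in> ?I}"
      using idx_bounded[of F F0 k] by blast
    then have "F \<in> ?S" using \<open>size F = k\<close> by simp
    with HF show "H \<in> image_mset val ` ?S" by blast
  qed
  ultimately show "finite {F \<in> factorizations prime_pair_monoid z. size F = k}"
    by (rule finite_surj)
qed

section \<open>Infinitely many factorizations of length two in the power monoid\<close>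

lemma singleton_atom:
  fixes a :: rat
  assumes "a \<in> atoms N"
  shows "{a} \<in> atoms (fin_power_monoid N)"
proof -
  have "R = {0} \<or> S = {0}"
    if R: "R \<subseteq> N" "R \<noteq> {}" and S: "S \<subseteq> N" "S \<noteq> {}" and eq: "{a} = R + S" for R S
  proof -
    have sum: "r + s = a" if "r \<in> R" "s \<in> S" for r s
      using set_plus_intro[OF that] unfolding eq[symmetric] by simp
    obtain r s where rs: "r \<in> R" "s \<in> S" using R S by auto
    have "r' = r" if "r' \<in> R" for r' using sum[OF that rs(2)] sum[OF rs] by simp
    then have "R = {r}" using rs(1) by blast
    moreover have "s' = s" if "s' \<in> S" for s' using sum[OF rs(1) that] sum[OF rs] by simp
    then have "S = {s}" using rs(2) by blast
    moreover have "r = 0 \<or> s = 0"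
      using assms sum[OF rs] rs R S unfolding atoms_def by blast
    ultimately show ?thesis by simp
  qed
  then show ?thesis using assms by (auto simp: atoms_def fin_power_monoid_def set_zero)
qed

text \<open>
  If both sets had two elements, their extreme elements would give three different sums.
\<close>
lemma singleton_or_singleton:
  fixes R S :: "rat set"
  assumes "finite R" "R \<noteq> {}" "finite S" "S \<noteq> {}" "card (R + S) \<le> 2"
  shows "is_singleton R \<or> is_singleton S"
proof (rule ccontr)
  assume "\<not> ?thesis"
  then have "Min R < Max R" "Min S < Max S"
    using assms by (metis Max_ge Min_le antisym is_singletonI' order.trans not_le)+
  moreover have "{Min R + Min S, Min R + Max S, Max R + Max S} \<subseteq> R + S"
    using assms by (simp add: set_plus_intro)
  then have "card {Min R + Min S, Min R + Max S, Max R + Max S} \<le> card (R + S)"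
    using assms by (intro card_mono finite_set_plus)
  ultimately show False using assms(5) by (auto simp: card_insert_if)
qed

text \<open>
  A factor of a two-element set is a singleton or has a singleton cofactor, and the element of that
  singleton divides both \<open>x\<close> and \<open>y\<close>.
\<close>
lemma coprime_pair_atom:
  fixes x y :: rat
  assumes "x \<in> N" "y \<in> N" "x \<noteq> y"
    and coprime: "\<And>u v w. \<lbrakk>u \<in> N; v \<in> N; w \<in> N; x = u + v; y = u + w\<rbrakk> \<Longrightarrow> u = 0"
  shows "{x, y} \<in> atoms (fin_power_monoid N)"
proof -
  have zero: "R = {0}"
    if R: "R \<subseteq> N" "is_singleton R" and S: "S \<subseteq> N" and eq: "{x, y} = R + S" for R S
  proof -
    obtain u where u: "R = {u}" using R by (auto simp: is_singleton_def)
    have "x \<in> R + S" "y \<in> R + S" by (auto simp: eq[symmetric])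
    then obtain v w where "v \<in> S" "w \<in> S" "x = u + v" "y = u + w"
      by (auto simp: u set_plus_def)
    then show ?thesis using coprime[of u v w] R S u by auto
  qed
  have "R = {0} \<or> S = {0}"
    if R: "R \<subseteq> N" "finite R" "R \<noteq> {}" and S: "S \<subseteq> N" "finite S" "S \<noteq> {}"
      and eq: "{x, y} = R + S" for R S
  proof -
    have "card (R + S) \<le> 2" using assms(3) by (simp add: eq[symmetric])
    then have "is_singleton R \<or> is_singleton S"
      using R S by (intro singleton_or_singleton)
    then show ?thesis using zero[of R S] zero[of S R] R S eq by (auto simp: add.commute)
  qed
  moreover have "{x, y} \<noteq> {0}" using assms(3) by auto
  ultimately show ?thesis using assms(1,2) by (auto simp: atoms_def fin_power_monoid_def set_zero)
qed

text \<open>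
  Adding \<open>Lead n\<close> to a representation of \<open>2 - val (Lead n)\<close> or \<open>3 - val (Lead n)\<close> yields one of 2
  or 3. By uniqueness the first uses only copies of \<open>Low n\<close> and the second only copies
  of \<open>High n\<close>, so a common divisor uses nothing.
\<close>
lemma cofactor_pair_atom:
  "{2 - val (Lead n), 3 - val (Lead n)} \<in> atoms (fin_power_monoid prime_pair_monoid)"
proof (rule coprime_pair_atom)
  have "2 - val (Lead n) = total (replicate_mset (p n) (Low n))"
    "3 - val (Lead n) = total (replicate_mset (q n) (High n))"
    using total_Low[of n] total_High[of n] by (simp_all del: val.simps)
  then show "2 - val (Lead n) \<in> prime_pair_monoid" "3 - val (Lead n) \<in> prime_pair_monoid"
    unfolding prime_pair_monoid_def by blast+
  fix u v w assume "u \<in> prime_pair_monoid" "v \<in> prime_pair_monoid" "w \<in> prime_pair_monoid"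
    and eqs: "2 - val (Lead n) = u + v" "3 - val (Lead n) = u + w"
  then obtain U V W where U: "u = total U" and V: "v = total V" and W: "w = total W"
    by (auto simp: prime_pair_monoid_def)
  have "total (add_mset (Lead n) (U + V)) = 2" "total (add_mset (Lead n) (U + W)) = 3"
    using eqs U V W by (simp_all del: val.simps)
  from representation_of_2[OF this(1), of "Lead n"] representation_of_3[OF this(2), of "Lead n"]
  have "U + V = replicate_mset (p n) (Low n)" "U + W = replicate_mset (q n) (High n)" by simp_all
  then have "set_mset (U + V) \<subseteq> {Low n}" "set_mset (U + W) \<subseteq> {High n}"
    by (simp_all only: set_mset_replicate_mset_subset) auto
  then have "set_mset U \<subseteq> {Low n} \<inter> {High n}"
    unfolding set_mset_union by blast
  also have "\<dots> = {}" by simp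
  finally have "U = {#}" by (simp only: subset_empty set_mset_eq_empty_iff)
  then show "u = 0" by (simp add: U)
qed simp

lemma not_LFFM_power: "\<not> LFFM (fin_power_monoid prime_pair_monoid)"
proof
  assume "LFFM (fin_power_monoid prime_pair_monoid)"
  define H where "H n = {#{val (Lead n)}, {2 - val (Lead n), 3 - val (Lead n)}#}" for n
  have "total (add_mset (Lead 0) (replicate_mset (p 0) (Low 0))) = 2"
    "total (add_mset (Lead 0) (replicate_mset (q 0) (High 0))) = 3"
    using total_Low[of 0] total_High[of 0] by (simp_all del: val.simps)
  then have "2 \<in> prime_pair_monoid" "3 \<in> prime_pair_monoid"
    unfolding prime_pair_monoid_def by (metis rangeI)+
  then have "{2, 3} \<in> fin_power_monoid prime_pair_monoid" by (simp add: fin_power_monoid_def)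
  with \<open>LFFM (fin_power_monoid prime_pair_monoid)\<close>
  have fin: "finite {F \<in> factorizations (fin_power_monoid prime_pair_monoid) {2, 3}. size F = 2}"
    unfolding LFFM_def by auto
  have "{val (Lead n)} + {2 - val (Lead n), 3 - val (Lead n)} = {2, 3}" for n
    by (auto simp: set_plus_def simp del: val.simps)
  moreover have "{val (Lead n)} \<in> atoms (fin_power_monoid prime_pair_monoid)" for n
    by (intro singleton_atom) (simp add: atoms_prime_pair_monoid del: val.simps)
  ultimately have sub: "range H \<subseteq> {F \<in> factorizations (fin_power_monoid prime_pair_monoid) {2, 3}. size F = 2}"
    using cofactor_pair_atom by (auto simp: H_def factorizations_def simp del: val.simps)
  \<comment> \<open>the two members of \<open>H n\<close> have different cardinalities, so the singleton determines \<open>n\<close>\<close>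
  have "inj H"
  proof (rule injI)
    fix m n assume "H m = H n"
    then have "{val (Lead m)} \<in># H n" by (metis H_def union_single_eq_member)
    then have "{val (Lead m)} = {val (Lead n)} \<or> {val (Lead m)} = {2 - val (Lead n), 3 - val (Lead n)}"
      by (simp add: H_def del: val.simps)
    then have "val (Lead m) = val (Lead n)" by auto
    then show "m = n" using p_ge_5[of m] p_ge_5[of n] p_eq_iff[of m n] by (auto simp: field_simps)
  qed
  then show False using finite_subset[OF sub fin] finite_imageD infinite_UNIV_nat by blast
qed

theorem proposition4p4:
  "\<exists>M :: rat set. puiseux_monoid M \<and> LFFM M \<and> \<not> LFFM (fin_power_monoid M)"
  using puiseux_prime_pair_monoid LFFM_prime_pair_monoid not_LFFM_power by blast

end
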